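(* Let $\Sigma$ be a finite alphabet. For any real $\rho>0$, the map $d_\rho:\Sigma^*\times\Sigma^*\to\mathbb{R}_{\ge 0}$, $d_\rho(S,T)=\sum_{n\ge 1}\rho^n\theta_n(S,T)$, is a metric on $\Sigma^*$.
   Context: $\Sigma$ is a finite set of characters; $\Sigma^n$ is the set of strings of length $n$ over $\Sigma$, and $\Sigma^*=\bigsqcup_{n\ge 0}\Sigma^n$ is the set of all finite strings (including the empty string $\epsilon$). $|S|$ denotes the length of $S$. For strings $S,Q$, the multiplicity $c(S,Q)$ is the number of pairs $(P_1,P_2)$ of strings with $S=P_1QP_2$. For $n\ge 1$, $[S]_n\in\mathbb{R}^{\Sigma^n}$ is the $n$-gram count vector $[S]_n(X)=c(S,X)$ for $X\in\Sigma^n$ (so $[S]_n=0$ if $|S|<n$). For vectors $u,v$ with nonnegative entries, the angle distance is $\theta(u,v)=\arccos\left(\frac{u\cdot v}{\|u\|\|v\|}\right)$ if $u,v\ne 0$ (Euclidean norm), $\theta(u,v)=0$ if $u=v=0$, and $\theta(u,v)=\pi/2$ if exactly one of $u,v$ is $0$. Set $\theta_n(S,T)=\theta([S]_n,[T]_n)$. Since $\theta_n(S,T)=0$ for $n>\max(|S|,|T|)$, the sum defining $d_\rho(S,T)$ is finite. *)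

theory Defs
  imports "HOL-Analysis.Analysis"
begin

text \<open>Strings over \<open>\<Sigma>\<close> are the lists in \<^term>\<open>lists \<Sigma>\<close>; the alphabet is an explicit set rather
  than a type, so it may be empty.\<close>

definition strings_of_length :: "'a set \<Rightarrow> nat \<Rightarrow> 'a list set" where
  "strings_of_length \<Sigma> n = {X \<in> lists \<Sigma>. length X = n}"

definition multiplicity_in :: "'a list \<Rightarrow> 'a list \<Rightarrow> nat" where
  "multiplicity_in S Q = card {(P1, P2). S = P1 @ Q @ P2}"

text \<open>A vector in \<open>\<real>\<^sup>I\<close> is a function of which only the values on the index set \<open>I\<close> matter.\<close>

definition ngram_count :: "'a set \<Rightarrow> nat \<Rightarrow> 'a list \<Rightarrow> 'a list \<Rightarrow> real" where
  "ngram_count \<Sigma> n S = (\<lambda>X \<in> strings_of_length \<Sigma> n. real (multiplicity_in S X))"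

definition angle_dist :: "'i set \<Rightarrow> ('i \<Rightarrow> real) \<Rightarrow> ('i \<Rightarrow> real) \<Rightarrow> real" where
  "angle_dist I u v =
    (if (\<forall>i\<in>I. u i = 0) \<and> (\<forall>i\<in>I. v i = 0) then 0
     else if (\<forall>i\<in>I. u i = 0) \<or> (\<forall>i\<in>I. v i = 0) then pi / 2
     else arccos ((\<Sum>i\<in>I. u i * v i) / (L2_set u I * L2_set v I)))"

definition ngram_angle :: "'a set \<Rightarrow> nat \<Rightarrow> 'a list \<Rightarrow> 'a list \<Rightarrow> real" where
  "ngram_angle \<Sigma> n S T =
    angle_dist (strings_of_length \<Sigma> n) (ngram_count \<Sigma> n S) (ngram_count \<Sigma> n T)"

definition d_rho :: "'a set \<Rightarrow> real \<Rightarrow> 'a list \<Rightarrow> 'a list \<Rightarrow> real" where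
  "d_rho \<Sigma> \<rho> S T = (\<Sum>\<^sub>\<infinity>n\<in>{1..}. \<rho> ^ n * ngram_angle \<Sigma> n S T)"

lemma ngram_angle_eq_0:
  assumes "n > max (length S) (length T)"
  shows "ngram_angle \<Sigma> n S T = 0"
proof -
  have "multiplicity_in R X = 0" if "length X = n" "length R < n" for R X :: "'a list"
  proof -
    have "{(P1, P2). R = P1 @ X @ P2} = {}"
      using that by auto
    then show ?thesis by (simp add: multiplicity_in_def)
  qed
  then show ?thesis
    using assms by (simp add: ngram_angle_def angle_dist_def ngram_count_def strings_of_length_def)
qed

text \<open>Hence the infinite sum has only finitely many nonzero terms, and the junk value of a divergent
  \<^const>\<open>infsum\<close> does not arise.\<close>

lemma d_rho_eq_finite_sum:
  "d_rho \<Sigma> \<rho> S T = (\<Sum>n = 1..max (length S) (length T). \<rho> ^ n * ngram_angle \<Sigma> n S T)"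
proof -
  have "d_rho \<Sigma> \<rho> S T =
      (\<Sum>\<^sub>\<infinity>n\<in>{1..max (length S) (length T)}. \<rho> ^ n * ngram_angle \<Sigma> n S T)"
    unfolding d_rho_def by (rule infsum_cong_neutral) (auto intro!: ngram_angle_eq_0)
  then show ?thesis by simp
qed

end

theory Submission
  imports Defs
begin

text \<open>All the axioms of a metric reduce to facts about the single angles \<open>\<theta>\<^sub>n\<close>, since the weights
  \<open>\<rho>\<^sup>n\<close> are positive and only finitely many angles are nonzero.

  Each \<open>\<theta>\<^sub>n\<close> is a pseudometric. Between nonzero vectors it is the spherical distance of their
  directions, whose triangle inequality (\<open>arccos_inner_triangle\<close>) comes from splitting two of the
  three unit vectors into components along and orthogonal to the third one. The zero vector behaves
  as an extra point at distance \<open>\<pi>/2\<close> from every direction; a detour through it has length \<open>\<pi>\<close>,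
  the largest possible angle, so the triangle inequality survives.

  Distinct strings are separated by the single value \<open>n = max |S| |T|\<close>: a string of length \<open>n\<close> has
  exactly one \<open>n\<close>-gram, itself, and a shorter string has none. So the count vectors of \<open>S\<close> and \<open>T\<close>
  are orthogonal at this \<open>n\<close> and at least one of them is nonzero; the angle is then \<open>\<pi>/2\<close>
  (\<open>ngram_angle_longest\<close>).\<close>

section \<open>Angles between real vectors\<close>

lemma cosine_bounds:
  fixes u v :: "'i \<Rightarrow> real"
  shows "\<bar>(\<Sum>i\<in>I. u i * v i) / (L2_set u I * L2_set v I)\<bar> \<le> 1"
proof -
  have "\<bar>\<Sum>i\<in>I. u i * v i\<bar> \<le> (\<Sum>i\<in>I. \<bar>u i\<bar> * \<bar>v i\<bar>)"
    by (rule order_trans[OF sum_abs]) (simp add: abs_mult)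
  also have "\<dots> \<le> L2_set u I * L2_set v I"
    by (rule L2_set_mult_ineq)
  finally show ?thesis
    by (simp add: abs_mult divide_le_eq)
qed

text \<open>Let \<open>\<alpha>\<close> and \<open>\<beta>\<close> be the angles from \<open>b\<close> to \<open>a\<close> and to \<open>c\<close>. Removing from \<open>a\<close> and \<open>c\<close> their
  components along \<open>b\<close>, of lengths \<open>cos \<alpha>\<close> and \<open>cos \<beta>\<close>, leaves vectors of norms \<open>sin \<alpha>\<close> and
  \<open>sin \<beta>\<close>. So by Cauchy--Schwarz the inner product of \<open>a\<close> and \<open>c\<close> is at least
  \<open>cos \<alpha> cos \<beta> - sin \<alpha> sin \<beta> = cos (\<alpha> + \<beta>)\<close>, and \<open>arccos\<close> is decreasing. This gives the claim
  when \<open>\<alpha> + \<beta> \<le> \<pi>\<close>; otherwise it is trivial.\<close>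

lemma arccos_inner_triangle:
  fixes a b c :: "'i \<Rightarrow> real"
  assumes a: "(\<Sum>i\<in>I. (a i)\<^sup>2) = 1" and b: "(\<Sum>i\<in>I. (b i)\<^sup>2) = 1" and c: "(\<Sum>i\<in>I. (c i)\<^sup>2) = 1"
  shows "arccos (\<Sum>i\<in>I. a i * c i)
    \<le> arccos (\<Sum>i\<in>I. a i * b i) + arccos (\<Sum>i\<in>I. b i * c i)"
proof -
  have L2: "L2_set a I = 1" "L2_set b I = 1" "L2_set c I = 1"
    using a b c by (simp_all add: L2_set_def)
  define x where "x = (\<Sum>i\<in>I. a i * b i)"
  define y where "y = (\<Sum>i\<in>I. b i * c i)"
  define z where "z = (\<Sum>i\<in>I. a i * c i)"
  have x1: "\<bar>x\<bar> \<le> 1" and y1: "\<bar>y\<bar> \<le> 1" and z1: "\<bar>z\<bar> \<le> 1"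
    using cosine_bounds[of a b I] cosine_bounds[of b c I] cosine_bounds[of a c I] L2
    by (simp_all add: x_def y_def z_def)
  have norm_a': "(\<Sum>i\<in>I. (a i - x * b i)\<^sup>2) = 1 - x\<^sup>2"
  proof -
    have "(\<Sum>i\<in>I. (a i - x * b i)\<^sup>2)
        = (\<Sum>i\<in>I. (a i)\<^sup>2) - 2 * x * (\<Sum>i\<in>I. a i * b i) + x\<^sup>2 * (\<Sum>i\<in>I. (b i)\<^sup>2)"
      by (simp add: sum_distrib_left flip: sum_subtractf sum.distrib)
        (simp add: power2_eq_square algebra_simps)
    then show ?thesis unfolding a b x_def[symmetric] by (simp add: power2_eq_square)
  qed
  have norm_c': "(\<Sum>i\<in>I. (c i - y * b i)\<^sup>2) = 1 - y\<^sup>2"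
  proof -
    have "(\<Sum>i\<in>I. (c i - y * b i)\<^sup>2)
        = (\<Sum>i\<in>I. (c i)\<^sup>2) - 2 * y * (\<Sum>i\<in>I. b i * c i) + y\<^sup>2 * (\<Sum>i\<in>I. (b i)\<^sup>2)"
      by (simp add: sum_distrib_left flip: sum_subtractf sum.distrib)
        (simp add: power2_eq_square algebra_simps)
    then show ?thesis unfolding c b y_def[symmetric] by (simp add: power2_eq_square)
  qed
  have inner: "(\<Sum>i\<in>I. (a i - x * b i) * (c i - y * b i)) = z - x * y"
  proof -
    have "(\<Sum>i\<in>I. (a i - x * b i) * (c i - y * b i))
        = (\<Sum>i\<in>I. a i * c i) - y * (\<Sum>i\<in>I. a i * b i) - x * (\<Sum>i\<in>I. b i * c i)
          + x * y * (\<Sum>i\<in>I. (b i)\<^sup>2)"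
      by (simp add: sum_distrib_left flip: sum_subtractf sum.distrib)
        (simp add: power2_eq_square algebra_simps)
    then show ?thesis by (simp add: b flip: x_def y_def z_def)
  qed
  have "\<bar>z - x * y\<bar> \<le> (\<Sum>i\<in>I. \<bar>a i - x * b i\<bar> * \<bar>c i - y * b i\<bar>)"
    unfolding inner[symmetric] by (rule order_trans[OF sum_abs]) (simp add: abs_mult)
  also have "\<dots> \<le> sqrt (1 - x\<^sup>2) * sqrt (1 - y\<^sup>2)"
    using L2_set_mult_ineq[of "\<lambda>i. a i - x * b i" "\<lambda>i. c i - y * b i" I]
    by (simp add: L2_set_def norm_a' norm_c')
  finally have z_ge: "x * y - sqrt (1 - x\<^sup>2) * sqrt (1 - y\<^sup>2) \<le> z" by linarith
  have "arccos z \<le> arccos x + arccos y"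
  proof (cases "arccos x + arccos y \<le> pi")
    case True
    have "cos (arccos x + arccos y) \<le> z"
      using z_ge x1 y1 by (simp add: cos_add sin_arccos_abs)
    then have "arccos z \<le> arccos (cos (arccos x + arccos y))"
      using z1 by (intro arccos_le_arccos) auto
    then show ?thesis
      using True x1 y1 by (simp add: arccos_cos arccos_lbound abs_le_iff)
  next
    case False
    then show ?thesis using arccos_ubound[of z] z1 by linarith
  qed
  then show ?thesis by (simp add: x_def y_def z_def)
qed

section \<open>The angle distance as a pseudometric\<close>

lemma angle_dist_nonneg: "0 \<le> angle_dist I u v"
proof -
  have "0 \<le> arccos ((\<Sum>i\<in>I. u i * v i) / (L2_set u I * L2_set v I))"
    using cosine_bounds[of u v I] by (intro arccos_lbound) linarith+
  then show ?thesis by (simp add: angle_dist_def)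
qed

lemma angle_dist_commute: "angle_dist I u v = angle_dist I v u"
  by (auto simp: angle_dist_def mult.commute)

lemma angle_dist_self:
  assumes "finite I"
  shows "angle_dist I u u = 0"
proof -
  have "arccos ((\<Sum>i\<in>I. u i * u i) / (L2_set u I * L2_set u I)) = 0" if "\<not> (\<forall>i\<in>I. u i = 0)"
  proof -
    have "L2_set u I * L2_set u I = (\<Sum>i\<in>I. u i * u i)"
      by (simp add: L2_set_def sum_nonneg power2_eq_square)
    moreover have "L2_set u I \<noteq> 0"
      using that assms by (simp add: L2_set_eq_0_iff)
    ultimately show ?thesis by (metis arccos_1 divide_self mult_eq_0_iff)
  qed
  then show ?thesis by (simp add: angle_dist_def)
qed

lemma angle_dist_orthogonal:
  assumes "(\<Sum>i\<in>I. u i * v i) = 0" and "\<exists>i\<in>I. u i \<noteq> 0"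
  shows "angle_dist I u v = pi / 2"
  using assms by (auto simp: angle_dist_def)

lemma angle_dist_le_pi: "angle_dist I u v \<le> pi"
proof -
  have "arccos ((\<Sum>i\<in>I. u i * v i) / (L2_set u I * L2_set v I)) \<le> pi"
    using cosine_bounds[of u v I] by (intro arccos_ubound) linarith+
  then show ?thesis by (simp add: angle_dist_def)
qed

text \<open>If one of the vectors is zero, the nonzero angles to it are \<open>\<pi>/2\<close>, and the bound \<open>\<pi>\<close> settles
  the case of a zero \<open>v\<close> between nonzero \<open>u\<close> and \<open>w\<close>. Otherwise normalising reduces the claim to
  unit vectors.\<close>

lemma angle_dist_triangle:
  assumes I: "finite I"
  shows "angle_dist I u w \<le> angle_dist I u v + angle_dist I v w"
proof (cases "(\<forall>i\<in>I. u i = 0) \<or> (\<forall>i\<in>I. v i = 0) \<or> (\<forall>i\<in>I. w i = 0)")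
  case True
  have half: "angle_dist I x y = pi / 2"
    if "(\<forall>i\<in>I. x i = 0) \<noteq> (\<forall>i\<in>I. y i = 0)" for x y :: "'a \<Rightarrow> real"
    using that by (auto simp: angle_dist_def)
  have zero: "angle_dist I x y = 0"
    if "\<forall>i\<in>I. x i = 0" "\<forall>i\<in>I. y i = 0" for x y :: "'a \<Rightarrow> real"
    using that by (simp add: angle_dist_def)
  show ?thesis
    using True half[of u w] half[of u v] half[of v w] zero[of u w] angle_dist_le_pi[of I u w]
      angle_dist_nonneg[of I u v] angle_dist_nonneg[of I v w]
    by (smt (verit) field_sum_of_halves pi_gt_zero)
next
  case False
  define unit where "unit x i = x i / L2_set x I" for x :: "'a \<Rightarrow> real" and i
  have norm: "(\<Sum>i\<in>I. (unit x i)\<^sup>2) = 1" if "\<not> (\<forall>i\<in>I. x i = 0)" for x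
  proof -
    have "(L2_set x I)\<^sup>2 = (\<Sum>i\<in>I. (x i)\<^sup>2)"
      by (simp add: L2_set_def sum_nonneg)
    moreover have "L2_set x I \<noteq> 0"
      using that I by (simp add: L2_set_eq_0_iff)
    ultimately show ?thesis
      by (simp add: unit_def power_divide flip: sum_divide_distrib)
        (metis divide_self power_not_zero)
  qed
  have eq: "angle_dist I x y = arccos (\<Sum>i\<in>I. unit x i * unit y i)"
    if "\<not> (\<forall>i\<in>I. x i = 0)" "\<not> (\<forall>i\<in>I. y i = 0)" for x y
    using that by (simp add: angle_dist_def unit_def flip: sum_divide_distrib)
  from False show ?thesis
    using arccos_inner_triangle[OF norm[of u] norm[of v] norm[of w]] by (simp add: eq)
qed

section \<open>Angles between n-gram count vectors\<close>

lemma finite_strings_of_length: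
  assumes "finite \<Sigma>"
  shows "finite (strings_of_length \<Sigma> n)"
  using finite_lists_length_eq[OF assms, of n]
  by (simp add: strings_of_length_def lists_eq_set)

lemma multiplicity_in_of_length_le:
  assumes "length S \<le> length Q"
  shows "multiplicity_in S Q = of_bool (S = Q)"
proof -
  have "P1 = [] \<and> P2 = [] \<and> S = Q" if "S = P1 @ Q @ P2" for P1 P2
    using that assms by auto
  then have "{(P1, P2). S = P1 @ Q @ P2} = (if S = Q then {([], [])} else {})"
    by auto
  then show ?thesis by (simp add: multiplicity_in_def)
qed

lemma ngram_angle_triangle:
  assumes "finite \<Sigma>"
  shows "ngram_angle \<Sigma> n S U \<le> ngram_angle \<Sigma> n S T + ngram_angle \<Sigma> n T U"
  unfolding ngram_angle_def
  by (intro angle_dist_triangle finite_strings_of_length assms)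

lemma ngram_angle_longest:
  assumes S: "S \<in> lists \<Sigma>" and "S \<noteq> T" and "length T \<le> length S"
  shows "ngram_angle \<Sigma> (length S) S T = pi / 2"
proof -
  let ?I = "strings_of_length \<Sigma> (length S)"
  have count_S: "ngram_count \<Sigma> (length S) S X = of_bool (S = X)" if "X \<in> ?I" for X
    using that by (simp add: ngram_count_def strings_of_length_def multiplicity_in_of_length_le)
  have count_T: "ngram_count \<Sigma> (length S) T X = of_bool (T = X)" if "X \<in> ?I" for X
    using that assms
    by (simp add: ngram_count_def strings_of_length_def multiplicity_in_of_length_le)
  show ?thesis
    unfolding ngram_angle_def
  proof (rule angle_dist_orthogonal)
    show "(\<Sum>X\<in>?I. ngram_count \<Sigma> (length S) S X * ngram_count \<Sigma> (length S) T X) = 0"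
      using \<open>S \<noteq> T\<close> by (intro sum.neutral) (auto simp: count_S count_T)
    show "\<exists>X\<in>?I. ngram_count \<Sigma> (length S) S X \<noteq> 0"
      using S by (intro bexI[of _ S]) (auto simp: count_S strings_of_length_def)
  qed
qed

section \<open>The weighted sum of the angles\<close>

lemma ngram_angle_nonneg: "0 \<le> ngram_angle \<Sigma> n S T"
  by (simp add: ngram_angle_def angle_dist_nonneg)

lemma ngram_angle_commute: "ngram_angle \<Sigma> n S T = ngram_angle \<Sigma> n T S"
  by (simp add: ngram_angle_def angle_dist_commute)

lemma d_rho_commute: "d_rho \<Sigma> \<rho> S T = d_rho \<Sigma> \<rho> T S"
  by (simp add: d_rho_def ngram_angle_commute[of \<Sigma> _ S T])

text \<open>A common range of summation for all the distances in one triangle.\<close>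

lemma d_rho_eq_sum_upto:
  assumes "length S \<le> N" and "length T \<le> N"
  shows "d_rho \<Sigma> \<rho> S T = (\<Sum>n = 1..N. \<rho> ^ n * ngram_angle \<Sigma> n S T)"
  unfolding d_rho_eq_finite_sum
  using assms by (intro sum.mono_neutral_left) (auto intro!: ngram_angle_eq_0)

lemma d_rho_nonneg:
  assumes "\<rho> > 0"
  shows "0 \<le> d_rho \<Sigma> \<rho> S T"
  unfolding d_rho_eq_finite_sum using assms by (intro sum_nonneg) (simp add: ngram_angle_nonneg)

lemma d_rho_self:
  assumes "finite \<Sigma>"
  shows "d_rho \<Sigma> \<rho> S S = 0"
  using assms
  by (simp add: d_rho_eq_finite_sum ngram_angle_def angle_dist_self finite_strings_of_length)

lemma d_rho_triangle:
  assumes "finite \<Sigma>" and "\<rho> > 0"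
  shows "d_rho \<Sigma> \<rho> S U \<le> d_rho \<Sigma> \<rho> S T + d_rho \<Sigma> \<rho> T U"
proof -
  define N where "N = max (length S) (max (length T) (length U))"
  have "\<rho> ^ n * ngram_angle \<Sigma> n S U
      \<le> \<rho> ^ n * ngram_angle \<Sigma> n S T + \<rho> ^ n * ngram_angle \<Sigma> n T U" for n
    using ngram_angle_triangle[OF \<open>finite \<Sigma>\<close>] \<open>\<rho> > 0\<close> by (simp flip: distrib_left)
  then show ?thesis
    by (simp add: d_rho_eq_sum_upto[of _ N] N_def sum_mono flip: sum.distrib)
qed

lemma d_rho_pos_of_length_le:
  assumes "\<rho> > 0" and "S \<in> lists \<Sigma>" and "S \<noteq> T" and "length T \<le> length S"
  shows "0 < d_rho \<Sigma> \<rho> S T"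
proof -
  \<comment> \<open>The term used for separation is part of the sum, which starts at \<open>n = 1\<close>.\<close>
  have "length S \<ge> 1"
    using \<open>S \<noteq> T\<close> \<open>length T \<le> length S\<close> by (cases S) auto
  then have "\<rho> ^ length S * ngram_angle \<Sigma> (length S) S T \<le> d_rho \<Sigma> \<rho> S T"
    using assms
    by (subst d_rho_eq_sum_upto[of _ "length S"])
      (auto intro!: member_le_sum simp: ngram_angle_nonneg)
  moreover have "0 < \<rho> ^ length S * ngram_angle \<Sigma> (length S) S T"
    using assms by (simp add: ngram_angle_longest)
  ultimately show ?thesis by linarith
qed

theorem proposition2p8:
  fixes \<Sigma> :: "'a set" and \<rho> :: real
  assumes "finite \<Sigma>" and "\<rho> > 0"
  shows "Metric_space (lists \<Sigma>) (d_rho \<Sigma> \<rho>)"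
proof
  fix S T U :: "'a list"
  show "0 \<le> d_rho \<Sigma> \<rho> S T"
    by (rule d_rho_nonneg[OF \<open>\<rho> > 0\<close>])
  show "d_rho \<Sigma> \<rho> S T = d_rho \<Sigma> \<rho> T S"
    by (rule d_rho_commute)
  show "d_rho \<Sigma> \<rho> S U \<le> d_rho \<Sigma> \<rho> S T + d_rho \<Sigma> \<rho> T U"
    by (rule d_rho_triangle[OF assms])
  assume "S \<in> lists \<Sigma>" and "T \<in> lists \<Sigma>"
  have "0 < d_rho \<Sigma> \<rho> S T" if "S \<noteq> T"
  proof (cases "length T \<le> length S")
    case True
    then show ?thesis
      using d_rho_pos_of_length_le[OF \<open>\<rho> > 0\<close> \<open>S \<in> lists \<Sigma>\<close> that] by simp
  next
    case False
    then show ?thesis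
      using d_rho_pos_of_length_le[OF \<open>\<rho> > 0\<close> \<open>T \<in> lists \<Sigma>\<close> that[symmetric]]
      by (simp add: d_rho_commute[of \<Sigma> \<rho> S T])
  qed
  then show "d_rho \<Sigma> \<rho> S T = 0 \<longleftrightarrow> S = T"
    using d_rho_self[OF \<open>finite \<Sigma>\<close>, of \<rho> S] by force
qed

end
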